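(* If $A=B[x;\sigma,\delta]$ is an Ore extension, then an ideal of $B$ is $\sigma$-$\delta$-invariant if and only if it is $A$-invariant.
   Context: $B$ is an associative and unital ring with a ring endomorphism $\sigma:B\to B$ and a $\sigma$-derivation $\delta$, i.e. an additive endomorphism of $B$ with $\delta(bc)=\sigma(b)\delta(c)+\delta(b)c$ for $b,c\in B$. The Ore extension $A=B[x;\sigma,\delta]$ is the (associative, unital) ring of polynomials over $B$ in the indeterminate $x$ (a free left $B$-module on the non-negative powers of $x$) subject to the relation $xb=\sigma(b)x+\delta(b)$ for $b\in B$. Ideals are two-sided. An ideal $I$ of $B$ is $\sigma$-$\delta$-invariant if $\sigma(I)\subseteq I$ and $\delta(I)\subseteq I$. An ideal $I$ of $B$ is $A$-invariant if $AI\subseteq IA$, where for subsets $X,Y$ of $A$, $XY$ denotes the set of all finite sums of products $xy$ with $x\in X$, $y\in Y$. *)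

theory Defs
  imports "HOL-Algebra.Algebra"
begin

locale sigma_derivation =
  ring B for B (structure) +
  fixes \<sigma> \<delta> :: "'a \<Rightarrow> 'a"
  assumes sigma_endo: "\<sigma> \<in> ring_hom B B"
    and delta_additive: "\<delta> \<in> hom (add_monoid B) (add_monoid B)"
    and delta_mult: "\<lbrakk>b \<in> carrier B; c \<in> carrier B\<rbrakk>
      \<Longrightarrow> \<delta> (b \<otimes> c) = \<sigma> b \<otimes> \<delta> c \<oplus> \<delta> b \<otimes> c"

text \<open>
  \<open>A\<close> is an Ore extension \<open>B[x;\<sigma>,\<delta>]\<close>, with \<open>B\<close> viewed inside \<open>A\<close> through \<open>\<iota>\<close>.
  The set \<^term>\<open>up B\<close> consists of the finitely supported sequences in \<open>B\<close>, so \<open>free_basis\<close> says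
  that \<open>A\<close> is a free left \<open>B\<close>-module on the powers of \<open>x\<close>; in particular \<open>\<iota>\<close> is injective.
  These conditions determine \<open>A\<close> up to an isomorphism that respects \<open>\<iota>\<close> and \<open>x\<close>.
\<close>

locale ore_extension =
  sigma_derivation B \<sigma> \<delta> + A: ring A
  for B :: "('b, 'm) ring_scheme" (structure)
    and \<sigma> \<delta> :: "'b \<Rightarrow> 'b"
    and A :: "('a, 'n) ring_scheme" +
  fixes \<iota> :: "'b \<Rightarrow> 'a" and x :: 'a
  assumes iota_hom: "\<iota> \<in> ring_hom B A"
    and x_carrier: "x \<in> carrier A"
    and x_commute: "b \<in> carrier B \<Longrightarrow>
      x \<otimes>\<^bsub>A\<^esub> \<iota> b = \<iota> (\<sigma> b) \<otimes>\<^bsub>A\<^esub> x \<oplus>\<^bsub>A\<^esub> \<iota> (\<delta> b)"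
    and free_basis: "p \<in> carrier A \<Longrightarrow>
      \<exists>!f. f \<in> up B \<and>
        p = (\<Oplus>\<^bsub>A\<^esub>i\<in>{i. f i \<noteq> \<zero>}. \<iota> (f i) \<otimes>\<^bsub>A\<^esub> (x [^]\<^bsub>A\<^esub> i))"

definition sigma_delta_invariant :: "('b \<Rightarrow> 'b) \<Rightarrow> ('b \<Rightarrow> 'b) \<Rightarrow> 'b set \<Rightarrow> bool" where
  "sigma_delta_invariant \<sigma> \<delta> I \<longleftrightarrow> \<sigma> ` I \<subseteq> I \<and> \<delta> ` I \<subseteq> I"

text \<open>
  Despite its name, \<^const>\<open>ideal_prod\<close> makes sense for arbitrary subsets: it is the set of finite
  nonempty sums of products. The empty sum adds nothing here, since \<open>0\<close> is itself a product when
  both factors contain \<open>0\<close>.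
\<close>

definition ring_invariant ::
    "('a, 'n) ring_scheme \<Rightarrow> ('b \<Rightarrow> 'a) \<Rightarrow> 'b set \<Rightarrow> bool" where
  "ring_invariant A \<iota> I \<longleftrightarrow>
     ideal_prod A (carrier A) (\<iota> ` I) \<subseteq> ideal_prod A (\<iota> ` I) (carrier A)"

end

theory Submission
  imports Defs
begin

text \<open>
  For \<open>b \<in> I\<close> invariance gives \<open>x b = \<sigma>(b) x + \<delta>(b) \<in> IA\<close>. The elements of \<open>IA\<close> are
  those polynomials whose coefficients (written on the left) all lie in \<open>I\<close>, so uniqueness of
  coefficients yields \<open>\<sigma>(b), \<delta>(b) \<in> I\<close>. Conversely, the elements \<open>a\<close> with
  \<open>a(IA) \<subseteq> IA\<close> form a subring that contains \<open>B\<close>, and by the commutation relation also \<open>x\<close>;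
  hence it is all of \<open>A\<close>.
\<close>

context ore_extension
begin

section \<open>Elements of A as coefficient sequences\<close>

text \<open>This is the sum in \<open>free_basis\<close>, named so that the axiom says:
  \<open>poly_sum\<close> is a bijection from \<open>up B\<close> onto the carrier of A.\<close>

definition poly_sum :: "(nat \<Rightarrow> 'b) \<Rightarrow> 'a" where
  "poly_sum f = (\<Oplus>\<^bsub>A\<^esub>i\<in>{i. f i \<noteq> \<zero>}. \<iota> (f i) \<otimes>\<^bsub>A\<^esub> (x [^]\<^bsub>A\<^esub> i))"

lemma iota_closed: "b \<in> carrier B \<Longrightarrow> \<iota> b \<in> carrier A"
  using iota_hom by (rule ring_hom_closed)

lemma iota_zero: "\<iota> \<zero> = \<zero>\<^bsub>A\<^esub>"
  using iota_hom ring_axioms A.ring_axioms by (rule ring_hom_zero)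

lemma sigma_closed: "b \<in> carrier B \<Longrightarrow> \<sigma> b \<in> carrier B"
  using sigma_endo by (rule ring_hom_closed)

lemma delta_closed: "b \<in> carrier B \<Longrightarrow> \<delta> b \<in> carrier B"
  using delta_additive by (auto simp: hom_def)

lemma up_closed: "f \<in> up B \<Longrightarrow> f i \<in> carrier B"
  by (auto simp: up_def)

lemma finite_support:
  assumes "f \<in> up B"
  shows "finite {i. f i \<noteq> \<zero>}"
proof -
  obtain n where "bound \<zero> n f" using bound_upD[OF assms] ..
  then have "{i. f i \<noteq> \<zero>} \<subseteq> {..n}" using bound_below by fast
  then show ?thesis by (rule finite_subset) simp
qed

lemma term_closed: "b \<in> carrier B \<Longrightarrow> \<iota> b \<otimes>\<^bsub>A\<^esub> (x [^]\<^bsub>A\<^esub> (i::nat)) \<in> carrier A"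
  using iota_closed x_carrier by simp

text \<open>Zero coefficients contribute zero terms. This frees the index set from the exact
  support, so that sums for different sequences can be compared over one common set.\<close>

lemma poly_sum_superset:
  assumes "f \<in> up B" "finite S" "{i. f i \<noteq> \<zero>} \<subseteq> S"
  shows "poly_sum f = (\<Oplus>\<^bsub>A\<^esub>i\<in>S. \<iota> (f i) \<otimes>\<^bsub>A\<^esub> (x [^]\<^bsub>A\<^esub> i))"
  unfolding poly_sum_def
  by (rule A.add.finprod_mono_neutral_cong_left)
    (use assms up_closed term_closed iota_zero x_carrier in auto)

lemma poly_sum_exists:
  assumes "p \<in> carrier A"
  obtains f where "f \<in> up B" "p = poly_sum f"
  using free_basis[OF assms] unfolding poly_sum_def by blast

lemma poly_sum_closed: "f \<in> up B \<Longrightarrow> poly_sum f \<in> carrier A"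
  unfolding poly_sum_def by (rule A.finsum_closed) (auto intro: term_closed up_closed)

lemma poly_sum_inj:
  assumes "f \<in> up B" "g \<in> up B" "poly_sum f = poly_sum g"
  shows "f = g"
  using free_basis[OF poly_sum_closed[OF assms(1)]] assms unfolding poly_sum_def by blast

lemma poly_sum_add:
  assumes f: "f \<in> up B" and g: "g \<in> up B"
  shows "poly_sum f \<oplus>\<^bsub>A\<^esub> poly_sum g = poly_sum (\<lambda>i. f i \<oplus> g i)"
proof -
  \<comment> \<open>The support of the sum may be smaller than this union, since coefficients can
    cancel.\<close>
  let ?S = "{i. f i \<noteq> \<zero>} \<union> {i. g i \<noteq> \<zero>}"
  have S: "finite ?S" using f g finite_support by blast
  have "poly_sum (\<lambda>i. f i \<oplus> g i)
      = (\<Oplus>\<^bsub>A\<^esub>i\<in>?S. \<iota> (f i \<oplus> g i) \<otimes>\<^bsub>A\<^esub> (x [^]\<^bsub>A\<^esub> i))"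
    by (rule poly_sum_superset[OF up_add_closed[OF f g] S]) auto
  also have "\<dots> = (\<Oplus>\<^bsub>A\<^esub>i\<in>?S. \<iota> (f i) \<otimes>\<^bsub>A\<^esub> (x [^]\<^bsub>A\<^esub> i)
      \<oplus>\<^bsub>A\<^esub> \<iota> (g i) \<otimes>\<^bsub>A\<^esub> (x [^]\<^bsub>A\<^esub> i))"
    using f g x_carrier
    by (intro A.finsum_cong')
      (simp_all add: ring_hom_add[OF iota_hom] up_closed iota_closed A.l_distr)
  also have "\<dots> = (\<Oplus>\<^bsub>A\<^esub>i\<in>?S. \<iota> (f i) \<otimes>\<^bsub>A\<^esub> (x [^]\<^bsub>A\<^esub> i))
      \<oplus>\<^bsub>A\<^esub> (\<Oplus>\<^bsub>A\<^esub>i\<in>?S. \<iota> (g i) \<otimes>\<^bsub>A\<^esub> (x [^]\<^bsub>A\<^esub> i))"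
    using f g by (intro A.finsum_addf) (auto intro: term_closed up_closed)
  also have "\<dots> = poly_sum f \<oplus>\<^bsub>A\<^esub> poly_sum g"
    using poly_sum_superset[OF f S] poly_sum_superset[OF g S] by simp
  finally show ?thesis ..
qed

lemma poly_sum_smult:
  assumes b: "b \<in> carrier B" and f: "f \<in> up B"
  shows "\<iota> b \<otimes>\<^bsub>A\<^esub> poly_sum f = poly_sum (\<lambda>i. b \<otimes> f i)"
proof -
  \<comment> \<open>Again possibly larger than the support of the product, since B may have zero
    divisors.\<close>
  let ?S = "{i. f i \<noteq> \<zero>}"
  have S: "finite ?S" using f by (rule finite_support)
  have "poly_sum (\<lambda>i. b \<otimes> f i)
      = (\<Oplus>\<^bsub>A\<^esub>i\<in>?S. \<iota> (b \<otimes> f i) \<otimes>\<^bsub>A\<^esub> (x [^]\<^bsub>A\<^esub> i))"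
    by (rule poly_sum_superset[OF up_smult_closed[OF b f] S]) (use b in auto)
  also have "\<dots> = (\<Oplus>\<^bsub>A\<^esub>i\<in>?S. \<iota> b \<otimes>\<^bsub>A\<^esub> (\<iota> (f i) \<otimes>\<^bsub>A\<^esub> (x [^]\<^bsub>A\<^esub> i)))"
    using b f x_carrier
    by (intro A.finsum_cong')
      (simp_all add: ring_hom_mult[OF iota_hom] up_closed iota_closed A.m_assoc)
  also have "\<dots> = \<iota> b \<otimes>\<^bsub>A\<^esub> poly_sum f"
    unfolding poly_sum_def
    using b f S by (intro A.finsum_rdistr[symmetric]) (auto intro: iota_closed term_closed up_closed)
  finally show ?thesis ..
qed

section \<open>From A-invariance to invariance under \<sigma> and \<delta>\<close>

text \<open>With coefficients on the left, those of \<open>\<iota> b\<close> times a are b times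
  those of a, and I absorbs multiplication from the right. Sums are handled coefficientwise.\<close>

lemma ideal_prod_coeffs:
  assumes I: "ideal I B" and p: "p \<in> ideal_prod A (\<iota> ` I) (carrier A)"
  shows "\<exists>f \<in> up B. p = poly_sum f \<and> range f \<subseteq> I"
  using p
proof induction
  case (prod c a)
  then obtain b where b: "b \<in> I" "c = \<iota> b" by blast
  then have bB: "b \<in> carrier B" using I by (simp add: ideal.Icarr)
  obtain f where f: "f \<in> up B" "a = poly_sum f" using poly_sum_exists prod by blast
  show ?case
    using f b bB poly_sum_smult[OF bB f(1)] up_smult_closed[OF bB f(1)] up_closed[OF f(1)]
    by (intro bexI[of _ "\<lambda>i. b \<otimes> f i"]) (auto intro: ideal.I_r_closed[OF I])
next
  case (sum p q)
  then obtain f g where f: "f \<in> up B" "p = poly_sum f" "range f \<subseteq> I"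
    and g: "g \<in> up B" "q = poly_sum g" "range g \<subseteq> I" by blast
  have "f i \<oplus> g i \<in> I" for i
    using f(3) g(3) additive_subgroup.a_closed[OF ideal.axioms(1)[OF I]] by blast
  then show ?case
    using f g poly_sum_add[OF f(1) g(1)] up_add_closed[OF f(1) g(1)]
    by (intro bexI[of _ "\<lambda>i. f i \<oplus> g i"]) auto
qed

text \<open>Supplies the coefficient sequence of the right-hand side of \<open>x_commute\<close>, to
  be used with b and c instantiated to \<open>\<sigma> b\<close> and
  \<open>\<delta> b\<close>.\<close>

lemma poly_sum_linear:
  assumes "b \<in> carrier B" "c \<in> carrier B"
  defines "f \<equiv> (\<lambda>i::nat. if i = 0 then c else if i = 1 then b else \<zero>)"
  shows "f \<in> up B" "poly_sum f = \<iota> b \<otimes>\<^bsub>A\<^esub> x \<oplus>\<^bsub>A\<^esub> \<iota> c"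
proof -
  show f: "f \<in> up B"
    unfolding up_def f_def using assms(1,2) by (auto intro!: exI[of _ 1] bound.intro)
  \<comment> \<open>The index set is fixed as {0, 1} because b or c may be zero and so drop out of
    the support.\<close>
  have "poly_sum f = (\<Oplus>\<^bsub>A\<^esub>i\<in>{0, 1}. \<iota> (f i) \<otimes>\<^bsub>A\<^esub> (x [^]\<^bsub>A\<^esub> i))"
    by (rule poly_sum_superset[OF f]) (auto simp: f_def)
  also have "\<dots> = \<iota> b \<otimes>\<^bsub>A\<^esub> x \<oplus>\<^bsub>A\<^esub> \<iota> c"
    using assms(1,2) x_carrier by (simp add: f_def iota_closed A.a_comm)
  finally show "poly_sum f = \<iota> b \<otimes>\<^bsub>A\<^esub> x \<oplus>\<^bsub>A\<^esub> \<iota> c" .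
qed

lemma sigma_delta_invariant_if_ring_invariant:
  assumes I: "ideal I B" and inv: "ring_invariant A \<iota> I"
  shows "sigma_delta_invariant \<sigma> \<delta> I"
proof -
  have "\<sigma> b \<in> I \<and> \<delta> b \<in> I" if b: "b \<in> I" for b
  proof -
    have bB: "b \<in> carrier B" using I b by (simp add: ideal.Icarr)
    have "x \<otimes>\<^bsub>A\<^esub> \<iota> b \<in> ideal_prod A (\<iota> ` I) (carrier A)"
      using inv b x_carrier unfolding ring_invariant_def by (blast intro: ideal_prod.prod)
    then obtain f where f: "f \<in> up B" "x \<otimes>\<^bsub>A\<^esub> \<iota> b = poly_sum f" "range f \<subseteq> I"
      using ideal_prod_coeffs[OF I] by blast
    note lin = poly_sum_linear[OF sigma_closed[OF bB] delta_closed[OF bB]]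
    \<comment> \<open>Both sequences represent x times \<open>\<iota> b\<close>: f by membership in
      IA, the other by the commutation relation.\<close>
    have "f = (\<lambda>i. if i = 0 then \<delta> b else if i = 1 then \<sigma> b else \<zero>)"
      by (rule poly_sum_inj[OF f(1) lin(1)]) (simp add: lin(2) f(2)[symmetric] x_commute[OF bB])
    then have "f 0 = \<delta> b" "f 1 = \<sigma> b" by simp_all
    then show ?thesis using f(3) by (metis range_subsetD)
  qed
  then show ?thesis unfolding sigma_delta_invariant_def by blast
qed

section \<open>IA absorbs left multiplication by A\<close>

lemma ideal_prod_closed:
  assumes I: "ideal I B" and p: "p \<in> ideal_prod A (\<iota> ` I) (carrier A)"
  shows "p \<in> carrier A"
  using p by induction (auto simp: iota_closed ideal.Icarr[OF I])

text \<open>On a generator, c(ba) = (cb)a, and cb stays in I because I is a left ideal.\<close>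

lemma ideal_prod_iota_left:
  assumes I: "ideal I B" and c: "c \<in> carrier B"
    and p: "p \<in> ideal_prod A (\<iota> ` I) (carrier A)"
  shows "\<iota> c \<otimes>\<^bsub>A\<^esub> p \<in> ideal_prod A (\<iota> ` I) (carrier A)"
  using p
proof induction
  case (prod d a)
  then obtain b where b: "b \<in> I" "d = \<iota> b" by blast
  then have bB: "b \<in> carrier B" using I by (simp add: ideal.Icarr)
  have "\<iota> c \<otimes>\<^bsub>A\<^esub> (d \<otimes>\<^bsub>A\<^esub> a) = \<iota> (c \<otimes> b) \<otimes>\<^bsub>A\<^esub> a"
    using b bB c prod by (simp add: ring_hom_mult[OF iota_hom] iota_closed A.m_assoc)
  then show ?case
    using prod b c by (auto intro: ideal_prod.prod ideal.I_l_closed[OF I])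
next
  case (sum p q)
  then show ?case
    using c by (simp add: A.r_distr iota_closed ideal_prod_closed[OF I] ideal_prod.sum)
qed

lemma ideal_prod_x_left:
  assumes I: "ideal I B" and inv: "sigma_delta_invariant \<sigma> \<delta> I"
    and p: "p \<in> ideal_prod A (\<iota> ` I) (carrier A)"
  shows "x \<otimes>\<^bsub>A\<^esub> p \<in> ideal_prod A (\<iota> ` I) (carrier A)"
  using p
proof induction
  case (prod d a)
  then obtain b where b: "b \<in> I" "d = \<iota> b" by blast
  then have bB: "b \<in> carrier B" using I by (simp add: ideal.Icarr)
  have sd: "\<sigma> b \<in> I" "\<delta> b \<in> I" using inv b unfolding sigma_delta_invariant_def by auto
  \<comment> \<open>Moving x past b gives \<open>\<sigma> b\<close> times xa plus
    \<open>\<delta> b\<close> times a. Invariance of I makes both summands generators of IA.\<close>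
  have "x \<otimes>\<^bsub>A\<^esub> (d \<otimes>\<^bsub>A\<^esub> a) = (x \<otimes>\<^bsub>A\<^esub> \<iota> b) \<otimes>\<^bsub>A\<^esub> a"
    using b bB prod x_carrier by (simp add: iota_closed A.m_assoc)
  also have "\<dots> = \<iota> (\<sigma> b) \<otimes>\<^bsub>A\<^esub> (x \<otimes>\<^bsub>A\<^esub> a) \<oplus>\<^bsub>A\<^esub> \<iota> (\<delta> b) \<otimes>\<^bsub>A\<^esub> a"
    using bB prod x_carrier
    by (simp add: x_commute iota_closed sigma_closed delta_closed A.m_assoc A.l_distr)
  finally show ?case
    using sd prod x_carrier by (simp add: ideal_prod.sum ideal_prod.prod)
next
  case (sum p q)
  then show ?case
    using x_carrier by (simp add: A.r_distr ideal_prod_closed[OF I] ideal_prod.sum)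
qed

text \<open>Expands a into terms \<open>\<iota> (f i)\<close> times a power of x and lets each
  factor act on p in turn, the power first.\<close>

lemma ideal_prod_left:
  assumes I: "ideal I B" and inv: "sigma_delta_invariant \<sigma> \<delta> I"
    and a: "a \<in> carrier A" and p: "p \<in> ideal_prod A (\<iota> ` I) (carrier A)"
  shows "a \<otimes>\<^bsub>A\<^esub> p \<in> ideal_prod A (\<iota> ` I) (carrier A)"
proof -
  let ?J = "ideal_prod A (\<iota> ` I) (carrier A)"
  have pA: "p \<in> carrier A" using ideal_prod_closed[OF I p] .
  \<comment> \<open>Since the power for \<open>Suc n\<close> is the n-th power times x on the right,
    the induction hypothesis is applied to xq; hence q must be arbitrary.\<close>
  have pow: "(x [^]\<^bsub>A\<^esub> (n::nat)) \<otimes>\<^bsub>A\<^esub> q \<in> ?J" if "q \<in> ?J" for n q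
    using that
  proof (induction n arbitrary: q)
    case 0
    then show ?case using ideal_prod_closed[OF I] by simp
  next
    case (Suc n)
    then show ?case
      using ideal_prod_x_left[OF I inv Suc.prems] ideal_prod_closed[OF I Suc.prems] x_carrier
      by (simp add: A.m_assoc)
  qed
  \<comment> \<open>\<open>ideal_prod\<close> has no empty sum, so zero is produced as
    \<open>\<iota> \<zero>\<close> times the given p. It serves the empty index set below.\<close>
  have zero: "\<zero>\<^bsub>A\<^esub> \<in> ?J"
    using ideal_prod_iota_left[OF I zero_closed p] pA by (simp add: iota_zero)
  obtain f where f: "f \<in> up B" "a = poly_sum f" using poly_sum_exists[OF a] .
  \<comment> \<open>The index set is detached from the support of f, so that it can shrink in the
    induction while f stays fixed.\<close>
  have "(\<Oplus>\<^bsub>A\<^esub>i\<in>S. \<iota> (f i) \<otimes>\<^bsub>A\<^esub> (x [^]\<^bsub>A\<^esub> i)) \<otimes>\<^bsub>A\<^esub> p \<in> ?J" if "finite S" for S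
    using that
  proof (induction S)
    case empty
    then show ?case using pA zero by simp
  next
    case (insert i S)
    have fc: "\<iota> (f j) \<otimes>\<^bsub>A\<^esub> (x [^]\<^bsub>A\<^esub> j) \<in> carrier A" for j
      using f by (auto intro: term_closed up_closed)
    have "(\<iota> (f i) \<otimes>\<^bsub>A\<^esub> (x [^]\<^bsub>A\<^esub> i)) \<otimes>\<^bsub>A\<^esub> p \<in> ?J"
      using ideal_prod_iota_left[OF I up_closed[OF f(1)] pow[OF p]] pA x_carrier
        iota_closed[OF up_closed[OF f(1)]] by (simp add: A.m_assoc)
    then show ?case
      using insert fc pA by (simp add: A.l_distr ideal_prod.sum Pi_def)
  qed
  then show ?thesis using f finite_support unfolding poly_sum_def by blast
qed

lemma ring_invariant_if_sigma_delta_invariant: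
  assumes I: "ideal I B" and inv: "sigma_delta_invariant \<sigma> \<delta> I"
  shows "ring_invariant A \<iota> I"
  unfolding ring_invariant_def
proof
  fix p assume "p \<in> ideal_prod A (carrier A) (\<iota> ` I)"
  then show "p \<in> ideal_prod A (\<iota> ` I) (carrier A)"
  proof induction
    case (prod a d)
    then have "d \<in> carrier A" using ideal.Icarr[OF I] iota_closed by auto
    \<comment> \<open>Writing d as d times one puts it in IA, where the left factor a can be
      absorbed.\<close>
    then have "d \<in> ideal_prod A (\<iota> ` I) (carrier A)"
      using ideal_prod.prod[OF prod(2) A.one_closed, of A] by simp
    then show ?case using ideal_prod_left[OF I inv] prod by blast
  qed (rule ideal_prod.sum)
qed

end

theorem proposition3p30:
  fixes B :: "('b, 'm) ring_scheme"
    and A :: "('a, 'n) ring_scheme"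
    and \<sigma> \<delta> :: "'b \<Rightarrow> 'b"
    and \<iota> :: "'b \<Rightarrow> 'a"
    and x :: 'a
    and I :: "'b set"
  assumes "ore_extension B \<sigma> \<delta> A \<iota> x"
    and "ideal I B"
  shows "sigma_delta_invariant \<sigma> \<delta> I \<longleftrightarrow> ring_invariant A \<iota> I"
  using ore_extension.sigma_delta_invariant_if_ring_invariant[OF assms]
    ore_extension.ring_invariant_if_sigma_delta_invariant[OF assms] by blast

end
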